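(* Let $\omega$ be weights, $\nu_\omega$ a sparse function, and $s$ a positive integer. Suppose the matrix $\Phi\in\mathbb{C}^{m\times N}$ satisfies $\omega$-RIP of order $s$ with $\delta$. Then there exists an invertible matrix $U\in\mathbb{C}^{m\times m}$ such that $U\Phi$ does not satisfy $\omega$-RIP of order $s$ with $\delta$, while $U\Phi$ satisfies $\omega$-RIP-NSP of order $s$ with $\delta$.
   Context: $[N]=\{1,\dots,N\}$; weights are $\omega=(\omega_1,\dots,\omega_N)$ with $\omega_j\ge0$. A sparse function $\nu_\omega$ assigns to every $S\subset[N]$ a real number $\nu_\omega(S)\ge 0$ with $\nu_\omega(S_1\cup S_2)=\nu_\omega(S_1)+\nu_\omega(S_2)$ for disjoint $S_1,S_2$. Standing assumption: $s\ge 2\max_{i\in[N]}\nu_\omega(\{i\})$. $\omega$-RIP: the $\omega$-RIP constant $\delta_{\omega,s}$ of order $s$ of $A\in\mathbb{C}^{m\times N}$ is the smallest number such that $(1-\delta_{\omega,s})\|x\|_2^2\le\|Ax\|_2^2\le(1+\delta_{\omega,s})\|x\|_2^2$ for every $x\in\mathbb{C}^N$ whose support $S$ satisfies $\nu_\omega(S)\le s$; then $A$ is said to satisfy $\omega$-RIP of order $s$ with constant $\delta_{\omega,s}$. $\omega$-RIP-NSP: a matrix satisfies $\omega$-RIP-NSP of order $s$ with $\delta$ if it has the same null space as some matrix that satisfies $\omega$-RIP of order $s$ with $\delta$.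
   Formalization: The matrix Φ is assumed nonzero: for Φ = 0 and δ = 1 the claim fails since UΦ = 0 for every U; for δ < 1 this is automatic. "RIP with δ" is read as: the RIP constant is at most δ. *)

theory Defs
  imports "HOL-Analysis.Analysis"
begin

definition weights :: "real ^ 'n \<Rightarrow> bool" where
  "weights \<omega> \<longleftrightarrow> (\<forall>j. 0 \<le> \<omega> $ j)"

text \<open>The index set $[N]$ is the finite type \<open>'n\<close>. The weights index a sparse
  function in name only: its axioms do not relate its values to them.\<close>

definition sparse_function :: "('n::finite set \<Rightarrow> real) \<Rightarrow> bool" where
  "sparse_function \<nu> \<longleftrightarrow>
     (\<forall>S. 0 \<le> \<nu> S) \<and> (\<forall>S T. S \<inter> T = {} \<longrightarrow> \<nu> (S \<union> T) = \<nu> S + \<nu> T)"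

definition supp :: "'a::zero ^ 'n \<Rightarrow> 'n set" where
  "supp x = {i. x $ i \<noteq> 0}"

definition RIP_bound ::
  "('n::finite set \<Rightarrow> real) \<Rightarrow> nat \<Rightarrow> complex ^ 'n ^ 'm::finite \<Rightarrow> real \<Rightarrow> bool" where
  "RIP_bound \<nu> s A \<delta> \<longleftrightarrow>
     (\<forall>x. \<nu> (supp x) \<le> real s \<longrightarrow>
        (1 - \<delta>) * (norm x)\<^sup>2 \<le> (norm (A *v x))\<^sup>2 \<and>
        (norm (A *v x))\<^sup>2 \<le> (1 + \<delta>) * (norm x)\<^sup>2)"

definition RIP_constant ::
  "('n::finite set \<Rightarrow> real) \<Rightarrow> nat \<Rightarrow> complex ^ 'n ^ 'm::finite \<Rightarrow> real" where
  "RIP_constant \<nu> s A = (LEAST \<delta>. RIP_bound \<nu> s A \<delta>)"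

text \<open>``RIP of order $s$ with \<open>\<delta>\<close>'' is read in the usual monotone sense: the RIP
  constant of order $s$ is at most \<open>\<delta>\<close>. Not satisfying RIP with \<open>\<delta>\<close> thus means
  that the RIP constant exceeds \<open>\<delta>\<close>.\<close>

definition satisfies_RIP ::
  "('n::finite set \<Rightarrow> real) \<Rightarrow> nat \<Rightarrow> complex ^ 'n ^ 'm::finite \<Rightarrow> real \<Rightarrow> bool" where
  "satisfies_RIP \<nu> s A \<delta> \<longleftrightarrow> RIP_constant \<nu> s A \<le> \<delta>"

definition null_space :: "complex ^ 'n ^ 'm \<Rightarrow> (complex ^ 'n) set" where
  "null_space A = {x. A *v x = 0}"

text \<open>The matrix sharing the null space is taken of the same size.\<close>

definition satisfies_RIP_NSP ::
  "('n::finite set \<Rightarrow> real) \<Rightarrow> nat \<Rightarrow> complex ^ 'n ^ 'm::finite \<Rightarrow> real \<Rightarrow> bool" where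
  "satisfies_RIP_NSP \<nu> s A \<delta> \<longleftrightarrow>
     (\<exists>B :: complex ^ 'n ^ 'm. null_space B = null_space A \<and> satisfies_RIP \<nu> s B \<delta>)"

text \<open>The least element in the definition of the RIP constant exists as soon as all
  singletons are admissible supports.\<close>

lemma supp_axis: "c \<noteq> 0 \<Longrightarrow> supp (axis i c) = {i}"
  by (auto simp: supp_def axis_def)

lemma RIP_constant_is_least:
  fixes A :: "complex ^ 'n::finite ^ 'm::finite"
  assumes single: "\<And>i. \<nu> {i} \<le> real s"
  shows "RIP_bound \<nu> s A (RIP_constant \<nu> s A)"
    and "RIP_bound \<nu> s A \<delta> \<Longrightarrow> RIP_constant \<nu> s A \<le> \<delta>"
proof -
  define D where "D = {d. RIP_bound \<nu> s A d}"
  have iff: "RIP_bound \<nu> s A d \<longleftrightarrow> (\<forall>x. \<nu> (supp x) \<le> real s \<longrightarrow>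
      \<bar>(norm (A *v x))\<^sup>2 - (norm x)\<^sup>2\<bar> \<le> d * (norm x)\<^sup>2)" for d
    unfolding RIP_bound_def by (auto simp: abs_le_iff algebra_simps)
  have "linear ((*v) A)"
    by (intro linearI)
      (simp_all add: vec_eq_iff matrix_vector_mult_def scaleR_sum_right
        distrib_left sum.distrib)
  then obtain C where C: "\<And>x. norm (A *v x) \<le> C * norm x"
    using linear_bounded by blast
  have "RIP_bound \<nu> s A (C\<^sup>2 + 1)"
    unfolding iff
  proof (intro allI impI)
    fix x :: "complex ^ 'n"
    have "(norm (A *v x))\<^sup>2 \<le> C\<^sup>2 * (norm x)\<^sup>2"
      using power_mono[OF C[of x], of 2] by (simp add: power_mult_distrib)
    moreover have "0 \<le> C\<^sup>2 * (norm x)\<^sup>2" "0 \<le> (norm (A *v x))\<^sup>2" "0 \<le> (norm x)\<^sup>2" by simp_all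
    ultimately show "\<bar>(norm (A *v x))\<^sup>2 - (norm x)\<^sup>2\<bar> \<le> (C\<^sup>2 + 1) * (norm x)\<^sup>2"
      unfolding abs_le_iff distrib_right by linarith
  qed
  then have ne: "D \<noteq> {}" by (auto simp: D_def)
  have nonneg: "0 \<le> d" if "d \<in> D" for d
  proof -
    let ?e = "axis undefined 1 :: complex ^ 'n"
    have "\<nu> (supp ?e) \<le> real s" using single by (simp add: supp_axis)
    then have "\<bar>(norm (A *v ?e))\<^sup>2 - (norm ?e)\<^sup>2\<bar> \<le> d * (norm ?e)\<^sup>2"
      using that unfolding D_def iff by blast
    then have "\<bar>(norm (A *v ?e))\<^sup>2 - 1\<bar> \<le> d" by simp
    then show ?thesis by linarith
  qed
  have bdd: "bdd_below D" using nonneg by (rule bdd_belowI)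
  have inf: "RIP_bound \<nu> s A (Inf D)"
    unfolding iff
  proof (intro allI impI)
    fix x :: "complex ^ 'n"
    assume x: "\<nu> (supp x) \<le> real s"
    show "\<bar>(norm (A *v x))\<^sup>2 - (norm x)\<^sup>2\<bar> \<le> Inf D * (norm x)\<^sup>2"
    proof (cases "x = 0")
      case False
      then have "\<bar>(norm (A *v x))\<^sup>2 - (norm x)\<^sup>2\<bar> / (norm x)\<^sup>2 \<le> d" if "d \<in> D" for d
        using that x by (simp add: D_def iff divide_le_eq)
      then have "\<bar>(norm (A *v x))\<^sup>2 - (norm x)\<^sup>2\<bar> / (norm x)\<^sup>2 \<le> Inf D"
        by (intro cInf_greatest ne)
      then show ?thesis using False by (simp add: divide_le_eq)
    qed simp
  qed
  have le: "Inf D \<le> d" if "RIP_bound \<nu> s A d" for d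
    using that bdd by (auto simp: D_def intro: cInf_lower)
  have "RIP_constant \<nu> s A = Inf D"
    unfolding RIP_constant_def using inf le by (intro Least_equality)
  then show "RIP_bound \<nu> s A (RIP_constant \<nu> s A)"
    and "RIP_bound \<nu> s A \<delta> \<Longrightarrow> RIP_constant \<nu> s A \<le> \<delta>"
    using inf le by auto
qed

lemma satisfies_RIP_iff:
  fixes A :: "complex ^ 'n::finite ^ 'm::finite"
  assumes single: "\<And>i. \<nu> {i} \<le> real s"
  shows "satisfies_RIP \<nu> s A \<delta> \<longleftrightarrow> RIP_bound \<nu> s A \<delta>"
proof
  assume "satisfies_RIP \<nu> s A \<delta>"
  then have "RIP_constant \<nu> s A \<le> \<delta>" by (simp add: satisfies_RIP_def)
  then have "(1 - \<delta>) * r \<le> (1 - RIP_constant \<nu> s A) * r"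
    and "(1 + RIP_constant \<nu> s A) * r \<le> (1 + \<delta>) * r" if "0 \<le> r" for r
    using that by (auto intro: mult_right_mono)
  then show "RIP_bound \<nu> s A \<delta>"
    using RIP_constant_is_least(1)[of \<nu> s A, OF single] unfolding RIP_bound_def
    by (meson order_trans zero_le_power2)
next
  assume "RIP_bound \<nu> s A \<delta>"
  then show "satisfies_RIP \<nu> s A \<delta>"
    using RIP_constant_is_least(2)[of \<nu> s A, OF single] by (simp add: satisfies_RIP_def)
qed

text \<open>In the customary range \<open>\<delta> < 1\<close>, RIP excludes the zero matrix.\<close>

lemma satisfies_RIP_nonzero:
  fixes A :: "complex ^ 'n::finite ^ 'm::finite"
  assumes "\<And>i. \<nu> {i} \<le> real s" and "satisfies_RIP \<nu> s A \<delta>" and "\<delta> < 1"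
  shows "A \<noteq> 0"
proof
  assume "A = 0"
  moreover have "(1 - \<delta>) * (norm (axis undefined 1 :: complex ^ 'n))\<^sup>2
      \<le> (norm (A *v axis undefined 1))\<^sup>2"
    using assms satisfies_RIP_iff[of \<nu> s A \<delta>] supp_axis[of "1 :: complex" "undefined :: 'n"] zero_neq_one
    unfolding RIP_bound_def by metis
  ultimately show False using \<open>\<delta> < 1\<close> by simp
qed

end

theory Submission
  imports Defs
begin

text \<open>Restricted isometry depends on the scale of a matrix, while its null space does not.
  Since \<open>\<Phi> \<noteq> 0\<close>, some column \<open>\<Phi> e\<^sub>i\<close> is nonzero, and the standing assumption on \<open>s\<close> makes
  the support \<open>{i}\<close> admissible. With \<open>U = c I\<close> for large \<open>c > 0\<close>, the vector \<open>U \<Phi> e\<^sub>i\<close> is so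
  long that the upper RIP bound with constant \<open>\<delta>\<close> fails at \<open>e\<^sub>i\<close>. As \<open>U\<close> is
  invertible, \<open>\<Phi>\<close> itself is a matrix with the null space of \<open>U \<Phi>\<close> that satisfies RIP.\<close>

lemma mat_of_real_mult_vector:
  fixes y :: "complex ^ 'm::finite"
  shows "mat (of_real c) *v y = c *\<^sub>R y"
  by (simp add: vec_eq_iff matrix_vector_mult_def mat_def if_distrib[of "\<lambda>z. z * _"]
      scaleR_conv_of_real[where 'a = complex] cong: if_cong)

lemma invertible_mat:
  fixes c :: "'a::field"
  assumes "c \<noteq> 0"
  shows "invertible (mat c :: 'a ^ 'm ^ 'm::finite)"
proof -
  have mult: "mat a ** mat b = (mat (a * b) :: 'a ^ 'm ^ 'm)" for a b
    by (simp add: vec_eq_iff matrix_matrix_mult_def mat_def if_distrib[of "\<lambda>z. z * _"]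
        cong: if_cong)
  show ?thesis
    unfolding invertible_def using assms
    by (intro exI[of _ "mat (inverse c)"]) (simp add: mult)
qed

lemma null_space_invertible_mult:
  fixes A :: "complex ^ 'n::finite ^ 'm::finite"
  assumes "invertible U"
  shows "null_space (U ** A) = null_space A"
proof -
  obtain V where V: "V ** U = mat 1" using assms unfolding invertible_def by blast
  have "U *v y = 0 \<longleftrightarrow> y = 0" for y
    by (metis V matrix_vector_mul_assoc matrix_vector_mul_lid matrix_vector_mult_0_right)
  then show ?thesis
    by (simp add: null_space_def flip: matrix_vector_mul_assoc)
qed

theorem proposition4p1:
  fixes \<omega> :: "real ^ 'n"
    and \<nu> :: "'n::finite set \<Rightarrow> real"
    and s :: nat
    and \<Phi> :: "complex ^ 'n ^ 'm::finite"
    and \<delta> :: real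
  assumes "weights \<omega>"
    and "sparse_function \<nu>"
    and "0 < s"
    and "real s \<ge> 2 * Max (range (\<lambda>i. \<nu> {i}))"
    and "satisfies_RIP \<nu> s \<Phi> \<delta>"
    and "\<Phi> \<noteq> 0"
  shows "\<exists>U :: complex ^ 'm ^ 'm. invertible U \<and>
           \<not> satisfies_RIP \<nu> s (U ** \<Phi>) \<delta> \<and>
           satisfies_RIP_NSP \<nu> s (U ** \<Phi>) \<delta>"
proof -
  have single: "\<nu> {i} \<le> real s" for i
  proof -
    have "\<nu> {i} \<le> Max (range (\<lambda>i. \<nu> {i}))" by (intro Max_ge) auto
    moreover have "0 \<le> \<nu> {i}" using assms(2) by (simp add: sparse_function_def)
    ultimately show ?thesis using assms(4) by linarith
  qed
  obtain i where i: "\<Phi> *v axis i 1 \<noteq> 0"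
  proof -
    obtain k i where "\<Phi> $ k $ i \<noteq> 0" using assms(6) by (auto simp: vec_eq_iff)
    moreover have "(\<Phi> *v axis i 1) $ k = \<Phi> $ k $ i"
      by (simp add: matrix_vector_mult_def axis_def if_distrib[of "\<lambda>z. _ * z"] cong: if_cong)
    ultimately show ?thesis using that[of i] by (metis zero_index)
  qed
  \<comment> \<open>The factor that scales the column to length \<open>\<bar>\<delta>\<bar> + 2\<close>, whose square exceeds \<open>1 + \<delta>\<close>.\<close>
  define c where "c = (\<bar>\<delta>\<bar> + 2) / norm (\<Phi> *v axis i 1)"
  define U :: "complex ^ 'm ^ 'm" where "U = mat (of_real c)"
  have "c \<noteq> 0" using i by (simp add: c_def)
  then have U: "invertible U" unfolding U_def by (intro invertible_mat) simp
  have "(U ** \<Phi>) *v axis i 1 = c *\<^sub>R (\<Phi> *v axis i 1)"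
    by (simp add: U_def mat_of_real_mult_vector flip: matrix_vector_mul_assoc)
  then have "norm ((U ** \<Phi>) *v axis i 1) = \<bar>\<delta>\<bar> + 2"
    using i by (simp add: c_def)
  moreover have "1 + \<delta> < (\<bar>\<delta>\<bar> + 2)\<^sup>2"
    using self_le_power[of "\<bar>\<delta>\<bar> + 2" 2] by linarith
  ultimately have "(1 + \<delta>) * (norm (axis i 1 :: complex ^ 'n))\<^sup>2
      < (norm ((U ** \<Phi>) *v axis i 1))\<^sup>2"
    by simp
  then have "\<not> RIP_bound \<nu> s (U ** \<Phi>) \<delta>"
    using single[of i] supp_axis[of "1 :: complex" i] unfolding RIP_bound_def
    by (metis not_less zero_neq_one)
  then have "\<not> satisfies_RIP \<nu> s (U ** \<Phi>) \<delta>"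
    by (simp add: satisfies_RIP_iff[of \<nu> s, OF single])
  moreover have "satisfies_RIP_NSP \<nu> s (U ** \<Phi>) \<delta>"
    unfolding satisfies_RIP_NSP_def null_space_invertible_mult[OF U] using assms(5) by blast
  ultimately show ?thesis using U by blast
qed

end
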